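(* Let $L\ge 2$ be an integer, let $s$ be a configuration of length $L$ (with periodic boundary conditions) and density $\rho$, and let $n=\lfloor (L-2)/2\rfloor$ and $m=\lfloor (L-1)/2\rfloor$. Then $F_{232}^{m}(F_{184}^{n}(s))$ consists only of 0's if $\rho<1/2$, and only of 1's if $\rho>1/2$. If $\rho=1/2$, then $F_{232}^{m}(F_{184}^{n}(s))$ is an alternating sequence of 0 and 1, i.e. $\ldots 01010101\ldots$ (any two cyclically adjacent cells have different states).
   Context: A configuration of length $L$ with periodic boundary conditions is a function $s:\mathbb{Z}/L\mathbb{Z}\to\{0,1\}$, $i\mapsto s_i$; its density is $\rho=\frac1L\sum_i s_i$, the fraction of 1's. An elementary cellular automaton rule is a map $f:\{0,1\}^3\to\{0,1\}$; the corresponding global mapping $F$ is $[F(s)]_i=f(s_{i-1},s_i,s_{i+1})$, with indices taken modulo $L$. $F^k$ denotes $F$ composed with itself $k$ times ($F^0$ is the identity). $F_{184}$ is the global mapping of rule 184, whose local rule is $000\mapsto 0$, $001\mapsto 0$, $010\mapsto 0$, $011\mapsto 1$, $100\mapsto 1$, $101\mapsto 1$, $110\mapsto 0$, $111\mapsto 1$. $F_{232}$ is the global mapping of rule 232 (the majority rule), whose local rule is $000\mapsto 0$, $001\mapsto 0$, $010\mapsto 0$, $011\mapsto 1$, $100\mapsto 0$, $101\mapsto 1$, $110\mapsto 1$, $111\mapsto 1$. *)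

theory Defs
  imports Complex_Main "HOL-Library.Z2"
begin

text \<open>
  A map \<open>\<int>/L\<int> \<rightarrow> {0,1}\<close> is represented by its pullback along \<open>\<int> \<rightarrow> \<int>/L\<int>\<close>, that is, by
  an \<open>L\<close>-periodic map \<open>int \<Rightarrow> bit\<close>, where \<open>bit\<close> is the two-element type with elements
  \<open>0\<close> and \<open>1\<close>. Reduction of indices modulo \<open>L\<close> is thereby implicit.
\<close>

definition configuration :: "nat \<Rightarrow> (int \<Rightarrow> bit) \<Rightarrow> bool" where
  "configuration L s \<longleftrightarrow> (\<forall>i. s (i + int L) = s i)"

definition density :: "nat \<Rightarrow> (int \<Rightarrow> bit) \<Rightarrow> real" where
  "density L s = real (card {i \<in> {0..<int L}. s i = 1}) / real L"

type_synonym local_rule = "bit \<Rightarrow> bit \<Rightarrow> bit \<Rightarrow> bit"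

definition global_map :: "local_rule \<Rightarrow> (int \<Rightarrow> bit) \<Rightarrow> (int \<Rightarrow> bit)" where
  "global_map f s = (\<lambda>i. f (s (i - 1)) (s i) (s (i + 1)))"

lemma configuration_global_map:
  assumes "configuration L s"
  shows "configuration L (global_map f s)"
proof -
  have p: "s (j + int L) = s j" for j
    using assms by (simp add: configuration_def)
  have "s (i + int L - 1) = s (i - 1)" "s (i + int L + 1) = s (i + 1)" for i
    using p[of "i - 1"] p[of "i + 1"] by (simp_all add: algebra_simps)
  then show ?thesis
    by (simp add: configuration_def global_map_def p)
qed

text \<open>The sets below list the neighbourhoods that are mapped to \<open>1\<close>.\<close>

definition rule184 :: local_rule where
  "rule184 a b c =
     (if (a, b, c) \<in> {(0, 1, 1), (1, 0, 0), (1, 0, 1), (1, 1, 1)} then 1 else 0)"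

definition rule232 :: local_rule where
  "rule232 a b c =
     (if (a, b, c) \<in> {(0, 1, 1), (1, 0, 1), (1, 1, 0), (1, 1, 1)} then 1 else 0)"

abbreviation F184 :: "(int \<Rightarrow> bit) \<Rightarrow> (int \<Rightarrow> bit)" where
  "F184 \<equiv> global_map rule184"

abbreviation F232 :: "(int \<Rightarrow> bit) \<Rightarrow> (int \<Rightarrow> bit)" where
  "F232 \<equiv> global_map rule232"

end

theory Submission
  imports Defs
begin

text \<open>
  Read a configuration as the slopes of a lattice path \<open>g\<close> on \<open>\<int>\<close>: down at a \<open>1\<close>, up at a \<open>0\<close>.
  Rule 184 then becomes \<open>g'(x) = min (g(x - 1)) (g(x + 1))\<close>, so after \<open>n\<close> steps the path at \<open>x\<close> is
  the minimum of \<open>g\<close> over the points \<open>x - n, x - n + 2, \<dots>, x + n\<close>. Over a period the path rises by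
  \<open>D\<close>, the number of \<open>0\<close>s minus the number of \<open>1\<close>s. If \<open>D \<ge> 0\<close>, a descent by two after \<open>n\<close> steps
  would need a new minimum at the right end of a window of width at least \<open>L - 1\<close>, which
  quasi-periodicity excludes; hence there are no adjacent \<open>1\<close>s. From then on rule 232 turns a cell
  into \<open>1\<close> only if both its neighbours are \<open>1\<close>, so a \<open>1\<close> surviving \<open>m\<close> steps comes from the
  pattern \<open>1?1?\<dots>?1\<close> on \<open>2 m + 1\<close> cells, which forces \<open>D \<le> 0\<close>. Exchanging \<open>0\<close> and \<open>1\<close> together
  with left and right gives the remaining cases.
\<close>

definition is_height :: "(int \<Rightarrow> int) \<Rightarrow> (int \<Rightarrow> bit) \<Rightarrow> bool" where
  "is_height g s \<longleftrightarrow> (\<forall>i. g (i + 1) = g i + (if s i = 1 then - 1 else 1))"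

definition min_step :: "(int \<Rightarrow> int) \<Rightarrow> (int \<Rightarrow> int)" where
  "min_step g x = min (g (x - 1)) (g (x + 1))"

text \<open>Addition in \<open>bit\<close> is exclusive or, so \<open>+ 1\<close> complements. Rule
  184 commutes with neither complement nor reflection alone, only with both.\<close>

definition mirror :: "(int \<Rightarrow> bit) \<Rightarrow> (int \<Rightarrow> bit)" where
  "mirror s i = s (- i) + 1"

subsection \<open>Height functions\<close>

definition isolated_ones :: "(int \<Rightarrow> bit) \<Rightarrow> bool" where
  "isolated_ones t \<longleftrightarrow> (\<forall>i. \<not> (t i = 1 \<and> t (i + 1) = 1))"

lemma isolated_onesD: "isolated_ones t \<Longrightarrow> \<not> (t i = 1 \<and> t (i + 1) = 1)"
  by (simp add: isolated_ones_def)

lemma is_heightD: "is_height g s \<Longrightarrow> g (i + 1) = g i + (if s i = 1 then - 1 else 1)"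
  by (simp add: is_height_def)

text \<open>Both new heights depend on \<open>g\<close> at \<open>i - 1\<close> to
  \<open>i + 2\<close> only, whose differences are the three slopes read by rule 184; eight cases
  remain.\<close>

lemma is_height_min_step:
  assumes "is_height g s"
  shows "is_height (min_step g) (F184 s)"
proof -
  have "min_step g (i + 1) = min_step g i + (if F184 s i = 1 then - 1 else 1)" for i
    using is_heightD[OF assms, of "i - 1"] is_heightD[OF assms, of i]
      is_heightD[OF assms, of "i + 1"]
    by (cases "s (i - 1)"; cases "s i"; cases "s (i + 1)")
      (simp_all add: min_step_def global_map_def rule184_def)
  then show ?thesis
    by (simp add: is_height_def)
qed

lemma is_height_min_step_funpow:
  assumes "is_height g s"
  shows "is_height ((min_step ^^ n) g) ((F184 ^^ n) s)"
  by (induction n) (simp_all add: assms is_height_min_step)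

lemma min_step_funpow_add_period:
  assumes "\<forall>x. g (x + p) = g x + D"
  shows "(min_step ^^ n) g (x + p) = (min_step ^^ n) g x + D"
proof (induction n arbitrary: x)
  case (Suc n)
  show ?case
    using Suc[of "x - 1"] Suc[of "x + 1"] by (simp add: min_step_def algebra_simps)
qed (simp add: assms)

lemma min_step_funpow_le:
  assumes "k \<le> n"
  shows "(min_step ^^ n) g x \<le> g (x - int n + 2 * int k)"
  using assms
proof (induction n arbitrary: k x)
  case (Suc n)
  show ?case
  proof (cases "k \<le> n")
    case True
    from Suc.IH[OF this, of "x - 1"] show ?thesis
      by (simp add: min_step_def algebra_simps)
  next
    case False
    with Suc.prems have "k = Suc n" by simp
    with Suc.IH[of n "x + 1"] show ?thesis
      by (simp add: min_step_def algebra_simps)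
  qed
qed simp

lemma min_step_funpow_attained:
  "\<exists>k\<le>n. (min_step ^^ n) g x = g (x - int n + 2 * int k)"
proof (induction n arbitrary: x)
  case (Suc n)
  obtain k where k: "k \<le> n" "(min_step ^^ n) g (x - 1) = g (x - 1 - int n + 2 * int k)"
    using Suc by blast
  obtain l where l: "l \<le> n" "(min_step ^^ n) g (x + 1) = g (x + 1 - int n + 2 * int l)"
    using Suc by blast
  show ?case
  proof (cases "(min_step ^^ n) g (x - 1) \<le> (min_step ^^ n) g (x + 1)")
    case True
    then have "(min_step ^^ Suc n) g x = (min_step ^^ n) g (x - 1)"
      by (simp add: min_step_def[of "(min_step ^^ n) g" x])
    with k show ?thesis
      by (intro exI[of _ k]) (simp add: algebra_simps)
  next
    case False
    then have "(min_step ^^ Suc n) g x = (min_step ^^ n) g (x + 1)"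
      by (simp add: min_step_def[of "(min_step ^^ n) g" x])
    with l show ?thesis
      by (intro exI[of _ "Suc l"]) (simp add: algebra_simps)
  qed
qed simp

lemma isolated_ones_F184:
  assumes g: "is_height g s" and per: "\<forall>x. g (x + int L) = g x + D"
    and "D \<ge> 0" "L \<ge> 2" and n: "n = (L - 2) div 2"
  shows "isolated_ones ((F184 ^^ n) s)"
  unfolding isolated_ones_def
proof (intro allI notI)
  fix x
  assume ones: "(F184 ^^ n) s x = 1 \<and> (F184 ^^ n) s (x + 1) = 1"
  let ?h = "(min_step ^^ n) g"
  note h = is_heightD[OF is_height_min_step_funpow[OF g, of n]]
  have drop: "?h (x + 2) = ?h x - 2"
    using h[of x] h[of "x + 1"] ones by (simp add: algebra_simps)
  obtain k where k: "k \<le> n" "?h (x + 2) = g (x + 2 - int n + 2 * int k)"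
    using min_step_funpow_attained by blast
  show False
  proof (cases "k = n")
    \<comment> \<open>This minimiser also lies in the window of \<open>x\<close>, so the path cannot
      have dropped.\<close>
    case False
    with k(1) have "?h x \<le> g (x - int n + 2 * int (Suc k))"
      by (intro min_step_funpow_le) simp
    with k(2) drop show False by (simp add: algebra_simps)
  next
    case True
    then have right: "?h (x + 2) = g (x + int n + 2)"
      using k(2) by (simp add: algebra_simps)
    \<comment> \<open>\<open>b\<close> is one period left of the new right end. By the choice of
      \<open>n\<close> it is the left end of the window of \<open>x\<close> or its left neighbour,
      so at most one unit is lost, against a drop of two.\<close>
    define b where "b = x + int n + 2 - int L"
    have gb: "g b \<le> g (x + int n + 2)"
      using spec[OF per, of b] \<open>D \<ge> 0\<close> by (simp add: b_def)
    have "L = 2 * n + 2 \<or> L = 2 * n + 3"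
      using n \<open>L \<ge> 2\<close> by presburger
    then have "x - int n = b \<or> x - int n = b + 1"
      by (auto simp: b_def)
    then have "g (x - int n) \<le> g b + 1"
      using is_heightD[OF g, of b] by auto
    moreover have "?h x \<le> g (x - int n)"
      using min_step_funpow_le[of 0 n g x] by simp
    ultimately show False
      using gb right drop by simp
  qed
qed

subsection \<open>Rule 232\<close>

text \<open>An isolated \<open>1\<close> is outvoted by its two neighbours; a \<open>0\<close> flips
  only if both neighbours are \<open>1\<close>.\<close>

lemma F232_eq_1_iff:
  assumes "isolated_ones t"
  shows "F232 t i = 1 \<longleftrightarrow> t (i - 1) = 1 \<and> t (i + 1) = 1"
  using isolated_onesD[OF assms, of "i - 1"] isolated_onesD[OF assms, of i]
  by (cases "t (i - 1)"; cases "t i"; cases "t (i + 1)")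
    (simp_all add: global_map_def rule232_def)

lemma isolated_ones_F232:
  assumes "isolated_ones t"
  shows "isolated_ones (F232 t)"
  using assms by (auto simp: isolated_ones_def F232_eq_1_iff[OF assms])

lemma F232_funpow_eq_1D:
  assumes "isolated_ones t" and "(F232 ^^ m) t i = 1" and "k \<le> m"
  shows "t (i - int m + 2 * int k) = 1"
  using assms
proof (induction m arbitrary: t k)
  case (Suc m)
  \<comment> \<open>The first application is split off, so the induction hypothesis is used for
    \<open>F232 t\<close>, which again has isolated ones.\<close>
  have one: "F232 t (i - int m + 2 * int j) = 1" if "j \<le> m" for j
    using Suc.IH[OF isolated_ones_F232[OF Suc.prems(1)] _ that] Suc.prems(2)
    by (simp add: funpow_swap1)
  show ?case
  proof (cases "k \<le> m")
    case True
    with one[of k] show ?thesis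
      by (simp add: F232_eq_1_iff[OF Suc.prems(1)] algebra_simps)
  next
    case False
    with Suc.prems(3) have "k = Suc m" by simp
    with one[of m] show ?thesis
      by (simp add: F232_eq_1_iff[OF Suc.prems(1)] algebra_simps)
  qed
qed simp

text \<open>In an alternating sequence both neighbours outvote the cell, so each step complements
  everything.\<close>

lemma F232_alternating:
  assumes "\<And>i. t i \<noteq> t (i + 1)"
  shows "F232 t i \<noteq> F232 t (i + 1)"
  using assms[of "i - 1"] assms[of i] assms[of "i + 1"]
  by (cases "t (i - 1)"; cases "t i"; cases "t (i + 1)"; cases "t (i + 1 + 1)")
    (simp_all add: global_map_def rule232_def)

lemma F232_funpow_alternating:
  assumes "\<And>i. t i \<noteq> t (i + 1)"
  shows "(F232 ^^ m) t i \<noteq> (F232 ^^ m) t (i + 1)"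
proof (induction m arbitrary: i)
  case (Suc m)
  then show ?case
    using F232_alternating[of "(F232 ^^ m) t" i] by simp
qed (simp add: assms)

lemma F232_F184_all_zero:
  assumes g: "is_height g s" and per: "\<forall>x. g (x + int L) = g x + D"
    and "D > 0" "L \<ge> 2" and n: "n = (L - 2) div 2" and m: "m = (L - 1) div 2"
  shows "(F232 ^^ m) ((F184 ^^ n) s) i = 0"
proof (rule ccontr)
  define t where "t = (F184 ^^ n) s"
  define h where "h = (min_step ^^ n) g"
  define a where "a = i - int m"
  have h: "h (x + 1) = h x + (if t x = 1 then - 1 else 1)" for x
    unfolding h_def t_def by (rule is_heightD[OF is_height_min_step_funpow[OF g]])
  have per_h: "h (x + int L) = h x + D" for x
    unfolding h_def by (rule min_step_funpow_add_period[OF per])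
  have iso: "isolated_ones t"
    unfolding t_def using assms by (intro isolated_ones_F184[OF g per]) auto
  assume "(F232 ^^ m) ((F184 ^^ n) s) i \<noteq> 0"
  then have "(F232 ^^ m) t i = 1"
    by (simp add: t_def)
  then have ones: "t (a + 2 * int k) = 1" if "k \<le> m" for k
    using F232_funpow_eq_1D[OF iso _ that, of i] by (simp add: a_def)
  \<comment> \<open>Every second slope is a descent, so two consecutive steps never gain
    height.\<close>
  have le: "h (a + 2 * int k) \<le> h a" if "k \<le> m" for k
    using that
  proof (induction k)
    case (Suc k)
    with ones[of k] h[of "a + 2 * int k"] h[of "a + 2 * int k + 1"] show ?case
      by (simp add: algebra_simps split: if_splits)
  qed simp
  have last: "h (a + 2 * int m + 1) \<le> h a - 1"
    using le[of m] ones[of m] h[of "a + 2 * int m"] by simp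
  \<comment> \<open>The pattern fills a whole period or all but one cell; that cell gains at most
    the one unit lost at the last \<open>1\<close>.\<close>
  have "L = 2 * m + 1 \<or> L = 2 * m + 2"
    using m \<open>L \<ge> 2\<close> by presburger
  then consider "a + int L = a + 2 * int m + 1" | "a + int L = a + 2 * int m + 1 + 1"
    by fastforce
  then have "h (a + int L) \<le> h a"
  proof cases
    case 1
    show ?thesis using last unfolding 1 by simp
  next
    case 2
    show ?thesis
      using last h[of "a + 2 * int m + 1"] unfolding 2 by (simp split: if_splits)
  qed
  with per_h[of a] \<open>D > 0\<close> show False by simp
qed

subsection \<open>Exchanging 0 and 1 together with left and right\<close>

text \<open>Cell \<open>i\<close> is the edge from \<open>i\<close> to \<open>i + 1\<close>, so
  sending cells to \<open>- i\<close> sends end points to \<open>1 - i\<close>. Reversal flips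
  slopes, as does complementing, hence no sign on \<open>g\<close>.\<close>

lemma is_height_mirror:
  assumes "is_height g s"
  shows "is_height (\<lambda>i. g (1 - i)) (mirror s)"
proof -
  have "g (1 - (i + 1)) = g (1 - i) + (if mirror s i = 1 then - 1 else 1)" for i
    using is_heightD[OF assms, of "- i"]
    by (cases "s (- i)") (simp_all add: mirror_def algebra_simps)
  then show ?thesis
    by (simp add: is_height_def)
qed

lemma F184_mirror: "F184 (mirror s) = mirror (F184 s)"
proof
  fix i
  show "F184 (mirror s) i = mirror (F184 s) i"
    by (cases "s (- i - 1)"; cases "s (- i)"; cases "s (- i + 1)")
      (simp_all add: mirror_def global_map_def rule184_def)
qed

lemma F232_mirror: "F232 (mirror s) = mirror (F232 s)"
proof
  fix i
  show "F232 (mirror s) i = mirror (F232 s) i"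
    by (cases "s (- i - 1)"; cases "s (- i)"; cases "s (- i + 1)")
      (simp_all add: mirror_def global_map_def rule232_def)
qed

lemma F184_funpow_mirror: "(F184 ^^ n) (mirror s) = mirror ((F184 ^^ n) s)"
  by (induction n) (simp_all add: F184_mirror)

lemma F232_funpow_mirror: "(F232 ^^ n) (mirror s) = mirror ((F232 ^^ n) s)"
  by (induction n) (simp_all add: F232_mirror)

lemma mirror_add_period:
  fixes g :: "int \<Rightarrow> int"
  assumes "\<forall>x. g (x + p) = g x + D"
  shows "\<forall>x. g (1 - (x + p)) = g (1 - x) + - D"
proof
  fix x
  show "g (1 - (x + p)) = g (1 - x) + - D"
    using spec[OF assms, of "1 - (x + p)"] by simp
qed

lemma F232_F184_all_one:
  assumes g: "is_height g s" and per: "\<forall>x. g (x + int L) = g x + D"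
    and "D < 0" "L \<ge> 2" "n = (L - 2) div 2" "m = (L - 1) div 2"
  shows "(F232 ^^ m) ((F184 ^^ n) s) i = 1"
proof -
  have "(F232 ^^ m) ((F184 ^^ n) (mirror s)) (- i) = 0"
    using assms
    by (intro F232_F184_all_zero[OF is_height_mirror[OF g] mirror_add_period[OF per]]) auto
  then show ?thesis
    by (cases "(F232 ^^ m) ((F184 ^^ n) s) i")
      (simp_all add: F184_funpow_mirror F232_funpow_mirror mirror_def)
qed

text \<open>Zero rise allows \<open>isolated_ones_F184\<close> for both \<open>s\<close> and
  \<open>mirror s\<close>, excluding adjacent \<open>1\<close>s and adjacent \<open>0\<close>s
  before rule 232 starts.\<close>

lemma F232_F184_alternating:
  assumes g: "is_height g s" and per: "\<forall>x. g (x + int L) = g x + 0"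
    and "L \<ge> 2" "n = (L - 2) div 2"
  shows "(F232 ^^ m) ((F184 ^^ n) s) i \<noteq> (F232 ^^ m) ((F184 ^^ n) s) (i + 1)"
proof (rule F232_funpow_alternating)
  fix x
  let ?t = "(F184 ^^ n) s"
  have "isolated_ones ?t"
    using assms by (intro isolated_ones_F184[OF g per]) auto
  then have "\<not> (?t x = 1 \<and> ?t (x + 1) = 1)"
    by (rule isolated_onesD)
  moreover have "isolated_ones ((F184 ^^ n) (mirror s))"
    using assms
    by (intro isolated_ones_F184[OF is_height_mirror[OF g] mirror_add_period[OF per]]) auto
  then have "\<not> (?t x = 0 \<and> ?t (x + 1) = 0)"
    using isolated_onesD[of "(F184 ^^ n) (mirror s)" "- x - 1"]
    by (auto simp: F184_funpow_mirror mirror_def add.commute)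
  ultimately show "?t x \<noteq> ?t (x + 1)"
    by (cases "?t x"; cases "?t (x + 1)") simp_all
qed

lemma configuration_height_exists:
  assumes "configuration L s"
  obtains g where "is_height g s"
    and "\<forall>x. g (x + int L) = g x + (int L - 2 * int (card {i \<in> {0..<int L}. s i = 1}))"
proof
  define w :: "int \<Rightarrow> int" where "w i = (if s i = 1 then - 1 else 1)" for i
  \<comment> \<open>For each \<open>i\<close> at least one sum is empty; this is the path through
    height 0 at the origin, extended both ways.\<close>
  define g where "g i = sum w {0..<i} - sum w {i..<0}" for i
  have step: "g (i + 1) = g i + w i" for i
  proof (cases "i \<ge> 0")
    case True
    then have "{0..<i + 1} = insert i {0..<i}" by auto
    with True show ?thesis by (simp add: g_def)
  next
    case False
    then have "{i..<0} = insert i {i + 1..<0}" by auto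
    with False show ?thesis by (simp add: g_def)
  qed
  then show "is_height g s"
    by (simp add: is_height_def w_def)
  have w: "w (i + int L) = w i" for i
    using assms by (simp add: w_def configuration_def)
  have "g (x + int L) = g x + g (int L)" for x
  proof (induction x rule: int_induct[where k = 0])
    case base
    show ?case by (simp add: g_def)
  next
    case (step1 i)
    then show ?case
      using step[of i] step[of "i + int L"] w[of i] by (simp add: algebra_simps)
  next
    case (step2 i)
    then show ?case
      using step[of "i - 1"] step[of "i - 1 + int L"] w[of "i - 1"] by (simp add: algebra_simps)
  qed
  moreover have "g (int L) = int L - 2 * int (card {i \<in> {0..<int L}. s i = 1})"
  proof -
    have "g (int L) = (\<Sum>i\<in>{0..<int L}. 1 - 2 * (if s i = 1 then 1 else 0))"
      by (auto simp: g_def w_def intro!: sum.cong)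
    also have "\<dots> = int L - 2 * (\<Sum>i\<in>{0..<int L}. if s i = 1 then 1 else 0)"
      by (simp add: sum_subtractf sum_distrib_left)
    also have "(\<Sum>i\<in>{0..<int L}. if s i = 1 then 1 else 0 :: int) =
        int (card {i \<in> {0..<int L}. s i = 1})"
      by (simp add: sum.inter_filter[symmetric])
    finally show ?thesis .
  qed
  ultimately show "\<forall>x. g (x + int L) = g x + (int L - 2 * int (card {i \<in> {0..<int L}. s i = 1}))"
    by simp
qed

theorem proposition4:
  fixes L n m :: nat and s :: "int \<Rightarrow> bit" and \<rho> :: real
  assumes "L \<ge> 2"
    and "configuration L s"
    and "\<rho> = density L s"
    and "n = (L - 2) div 2"
    and "m = (L - 1) div 2"
  shows "(\<rho> < 1/2 \<longrightarrow> (\<forall>i. (F232 ^^ m) ((F184 ^^ n) s) i = 0)) \<and>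
         (\<rho> > 1/2 \<longrightarrow> (\<forall>i. (F232 ^^ m) ((F184 ^^ n) s) i = 1)) \<and>
         (\<rho> = 1/2 \<longrightarrow> (\<forall>i. (F232 ^^ m) ((F184 ^^ n) s) i \<noteq> (F232 ^^ m) ((F184 ^^ n) s) (i + 1)))"
proof -
  define D where "D = int L - 2 * int (card {i \<in> {0..<int L}. s i = 1})"
  obtain g where g: "is_height g s" and per: "\<forall>x. g (x + int L) = g x + D"
    using configuration_height_exists[OF assms(2)] unfolding D_def by metis
  have "real_of_int D = real L * (1 - 2 * \<rho>)"
    using \<open>L \<ge> 2\<close> by (simp add: assms(3) density_def D_def field_simps)
  moreover have "real L > 0"
    using \<open>L \<ge> 2\<close> by simp
  ultimately have "real_of_int D > 0 \<longleftrightarrow> 1 - 2 * \<rho> > 0" "real_of_int D < 0 \<longleftrightarrow> 1 - 2 * \<rho> < 0"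
    by (simp_all only: zero_less_mult_iff mult_less_0_iff) auto
  then have sign: "\<rho> < 1/2 \<longleftrightarrow> D > 0" "\<rho> > 1/2 \<longleftrightarrow> D < 0" "\<rho> = 1/2 \<longleftrightarrow> D = 0"
    by auto
  show ?thesis
    unfolding sign
    using F232_F184_all_zero[OF g per _ assms(1,4,5)] F232_F184_all_one[OF g per _ assms(1,4,5)]
      F232_F184_alternating[OF g _ assms(1,4)] per
    by simp
qed

end
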